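(* Let $(\sigma,\alpha)$ be a collection of hypermaps of genus zero. Then exchanging the two variables in the Whitney polynomial of $(\sigma,\alpha)$ yields the Whitney polynomial of its dual $(\alpha^{-1}\sigma,\alpha^{-1})$: $$R(\sigma,\alpha;u,v)=R(\alpha^{-1}\sigma,\alpha^{-1};v,u).$$
   Context: Permutations act on a finite set and are composed from right to left: $(\pi\rho)(i)=\pi(\rho(i))$; $z(\pi)$ is the number of cycles of $\pi$ (fixed points included). A collection of hypermaps $(\sigma,\alpha)$ on a finite set of points is an ordered pair of permutations of that set. Its connected components are the orbits of the permutation group generated by $\sigma$ and $\alpha$ (with the restrictions of $\sigma$ and $\alpha$); their number is $\kappa(\sigma,\alpha)$. It is a hypermap if $\kappa(\sigma,\alpha)=1$. The genus $g(\sigma,\alpha)$ of a hypermap on $n$ points is the nonnegative integer defined by $n+2-2g(\sigma,\alpha)=z(\sigma)+z(\alpha)+z(\alpha^{-1}\sigma)$; the genus of a collection of hypermaps is the sum of the genera of its connected components. A permutation $\beta$ is a refinement of $\alpha$ (written $\beta\le\alpha$) if $\beta$ is obtained by replacing each cycle $\alpha_i$ of $\alpha$ by a permutation $\beta_i$ acting on the same set of $n_i$ points such that $g(\alpha_i,\beta_i)=0$, that is, $z(\beta_i)+z(\beta_i^{-1}\alpha_i)=n_i+1$. The Whitney polynomial of a collection of hypermaps $(\sigma,\alpha)$ on $n$ points is $$R(\sigma,\alpha;u,v)=\sum_{\beta\leq\alpha}u^{\kappa(\sigma,\beta)-\kappa(\sigma,\alpha)}\,v^{\kappa(\sigma,\beta)+n-z(\beta)-z(\sigma)}.$$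 *)

theory Defs
  imports
    "HOL-Combinatorics.Permutations"
    "HOL-Combinatorics.Orbits"
    "HOL-Algebra.Generated_Groups"
begin

text \<open>
  Points form a finite set \<open>S\<close>; a permutation of \<open>S\<close> is a function \<open>p\<close> with \<open>p permutes S\<close>,
  hence the identity outside \<open>S\<close>. Products are composed from right to left, so the product of
  \<open>p\<close> and \<open>q\<close> is \<open>p \<circ> q\<close>.

  The inverse of a permutation is written \<open>Hilbert_Choice.inv\<close>, since a bare \<open>inv\<close> is parsed as
  the inverse in an implicit group structure once HOL-Algebra is loaded.
\<close>

text \<open>\<open>orbit p x\<close> is the cycle of \<open>p\<close> through \<open>x\<close>; it is \<open>{x}\<close> when \<open>x\<close> is a fixed point.\<close>

definition cycles :: "'a set \<Rightarrow> ('a \<Rightarrow> 'a) \<Rightarrow> 'a set set" where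
  "cycles S p = orbit p ` S"

definition num_cycles :: "'a set \<Rightarrow> ('a \<Rightarrow> 'a) \<Rightarrow> nat" where
  "num_cycles S p = card (cycles S p)"

definition hypermap_collection :: "'a set \<Rightarrow> ('a \<Rightarrow> 'a) \<Rightarrow> ('a \<Rightarrow> 'a) \<Rightarrow> bool" where
  "hypermap_collection S \<sigma> \<alpha> \<longleftrightarrow> finite S \<and> \<sigma> permutes S \<and> \<alpha> permutes S"

definition perm_group :: "'a set \<Rightarrow> ('a \<Rightarrow> 'a) monoid" where
  "perm_group S = \<lparr>carrier = {p. p permutes S}, mult = (\<circ>), one = id\<rparr>"

lemma group_perm_group: "group (perm_group S)"
proof (rule groupI)
  fix p assume "p \<in> carrier (perm_group S)"
  then show "\<exists>q\<in>carrier (perm_group S). q \<otimes>\<^bsub>perm_group S\<^esub> p = \<one>\<^bsub>perm_group S\<^esub>"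
    by (intro bexI[of _ "Hilbert_Choice.inv p"])
      (auto simp: perm_group_def permutes_inv permutes_inv_o)
qed (auto simp: perm_group_def permutes_compose permutes_id comp_assoc)

lemma inv_perm_group:
  assumes "p permutes S"
  shows "inv\<^bsub>perm_group S\<^esub> p = Hilbert_Choice.inv p"
proof -
  interpret group "perm_group S" by (rule group_perm_group)
  show ?thesis
    using assms by (intro inv_equality) (auto simp: perm_group_def permutes_inv permutes_inv_o)
qed

definition components :: "'a set \<Rightarrow> ('a \<Rightarrow> 'a) \<Rightarrow> ('a \<Rightarrow> 'a) \<Rightarrow> 'a set set" where
  "components S \<sigma> \<alpha> = (\<lambda>x. {g x | g. g \<in> generate (perm_group S) {\<sigma>, \<alpha>}}) ` S"

definition num_components :: "'a set \<Rightarrow> ('a \<Rightarrow> 'a) \<Rightarrow> ('a \<Rightarrow> 'a) \<Rightarrow> nat" where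
  "num_components S \<sigma> \<alpha> = card (components S \<sigma> \<alpha>)"

text \<open>
  The genus of a (connected) hypermap on the point set \<open>S\<close>: the natural number \<open>g\<close> with
  \<open>n + 2 - 2g = z(\<sigma>) + z(\<alpha>) + z(\<alpha>\<inverse>\<sigma>)\<close>.
\<close>

definition hypermap_genus :: "'a set \<Rightarrow> ('a \<Rightarrow> 'a) \<Rightarrow> ('a \<Rightarrow> 'a) \<Rightarrow> nat" where
  "hypermap_genus S \<sigma> \<alpha> = (THE g :: nat.
     int (card S) + 2 - 2 * int g =
     int (num_cycles S \<sigma>) + int (num_cycles S \<alpha>) + int (num_cycles S (Hilbert_Choice.inv \<alpha> \<circ> \<sigma>)))"

definition genus :: "'a set \<Rightarrow> ('a \<Rightarrow> 'a) \<Rightarrow> ('a \<Rightarrow> 'a) \<Rightarrow> nat" where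
  "genus S \<sigma> \<alpha> =
     (\<Sum>C\<in>components S \<sigma> \<alpha>. hypermap_genus C (perm_restrict \<sigma> C) (perm_restrict \<alpha> C))"

text \<open>
  \<open>perm_refines S \<beta> \<alpha>\<close> is \<open>\<beta> \<le> \<alpha>\<close>. The equation on a cycle \<open>C\<close> of \<open>\<alpha>\<close> says that the hypermap formed by
  the restrictions of \<open>\<alpha>\<close> and \<open>\<beta>\<close> to \<open>C\<close> has genus zero; there the restriction of \<open>\<alpha>\<close> has exactly
  one cycle.
\<close>

definition perm_refines :: "'a set \<Rightarrow> ('a \<Rightarrow> 'a) \<Rightarrow> ('a \<Rightarrow> 'a) \<Rightarrow> bool" where
  "perm_refines S \<beta> \<alpha> \<longleftrightarrow> \<beta> permutes S \<and>
     (\<forall>C\<in>cycles S \<alpha>. perm_restrict \<beta> C permutes C \<and>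
        num_cycles C (perm_restrict \<beta> C) +
        num_cycles C (Hilbert_Choice.inv (perm_restrict \<beta> C) \<circ> perm_restrict \<alpha> C) = card C + 1)"

text \<open>
  The Whitney polynomial with arbitrary elements \<open>u\<close>, \<open>v\<close> of a commutative ring in place of the
  two variables; the ring may itself be a polynomial ring with indeterminates \<open>u\<close> and \<open>v\<close>, such as
  \<open>int poly poly\<close>. The subtractions in the exponents are on \<open>nat\<close>, but no truncation occurs when
  \<open>\<beta>\<close> refines \<open>\<alpha>\<close>: the components of \<open>(\<sigma>, \<beta>)\<close> refine those of \<open>(\<sigma>, \<alpha>)\<close>, and
  \<open>\<kappa>(\<sigma>, \<beta>) + n - z(\<beta>) - z(\<sigma>) = z(\<beta>\<inverse>\<sigma>) - \<kappa>(\<sigma>, \<beta>) + 2 g(\<sigma>, \<beta>) \<ge> 0\<close>.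
\<close>

definition whitney ::
  "'a set \<Rightarrow> ('a \<Rightarrow> 'a) \<Rightarrow> ('a \<Rightarrow> 'a) \<Rightarrow> 'b \<Rightarrow> 'b \<Rightarrow> 'b::comm_ring_1" where
  "whitney S \<sigma> \<alpha> u v =
     (\<Sum>\<beta> | perm_refines S \<beta> \<alpha>.
        u ^ (num_components S \<sigma> \<beta> - num_components S \<sigma> \<alpha>) *
        v ^ (num_components S \<sigma> \<beta> + card S - num_cycles S \<beta> - num_cycles S \<sigma>))"

end

(* Call double genus of (\<sigma>, \<beta>) the number n + 2\<kappa>(\<sigma>, \<beta>) - z(\<sigma>) - z(\<beta>) - z(\<beta>\<inverse>\<sigma>). Multiplying \<beta> on
   the right by a transposition that joins two of its cycles leaves the double genus unchanged or
   raises it by 2. A refinement \<beta> of \<alpha> leads to \<alpha> by such steps, since z(\<beta>) + z(\<beta>\<inverse>\<alpha>) = n + z(\<alpha>),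
   and the identity leads to \<beta>; hence every refinement of \<alpha> has genus zero with \<sigma> if \<alpha> has.
   The map \<beta> \<mapsto> \<beta>' = \<alpha>\<inverse>\<beta> is a bijection from the refinements of \<alpha> to those of \<alpha>\<inverse>, and with
   \<sigma>' = \<alpha>\<inverse>\<sigma> one has \<beta>'\<inverse>\<sigma>' = \<beta>\<inverse>\<sigma>. Combining the genus formulas of (\<sigma>, \<alpha>), (\<sigma>, \<beta>) and (\<sigma>', \<beta>')
   gives \<kappa>(\<sigma>, \<beta>) + \<kappa>(\<sigma>', \<beta>') = \<kappa>(\<sigma>, \<alpha>) + z(\<beta>\<inverse>\<sigma>), which says that \<beta> \<mapsto> \<beta>' swaps the exponents. *)

theory Submission
  imports Defs
begin

section \<open>Classes of the equivalence generated by a relation\<close>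

abbreviation swap :: "'a \<Rightarrow> 'a \<Rightarrow> 'a \<Rightarrow> 'a" where
  "swap \<equiv> Transposition.transpose"

abbreviation perm_inv :: "('a \<Rightarrow> 'b) \<Rightarrow> 'b \<Rightarrow> 'a" where
  "perm_inv \<equiv> Hilbert_Choice.inv"

definition arrows :: "('a \<Rightarrow> 'a) \<Rightarrow> 'a rel" where
  "arrows p = {(x, y). y = p x}"

definition conn :: "'a rel \<Rightarrow> 'a rel" where
  "conn R = (R \<union> R\<inverse>)\<^sup>*"

text \<open>Classes are formed in the whole type, so all blocks lie inside \<open>S\<close> only if
  \<open>R\<close> links no point of \<open>S\<close> to a point outside. Cycles and components both
  become such blocks, which reduces their counting to adding one pair to a relation.\<close>

definition blocks :: "'a set \<Rightarrow> 'a rel \<Rightarrow> 'a set set" where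
  "blocks S R = (\<lambda>x. conn R `` {x}) ` S"

lemma conn_refl [simp]: "(x, x) \<in> conn R"
  by (simp add: conn_def)

lemma conn_base: "r \<in> R \<Longrightarrow> r \<in> conn R"
  by (auto simp: conn_def)

lemma conn_sym: "(x, y) \<in> conn R \<Longrightarrow> (y, x) \<in> conn R"
  unfolding conn_def by (rule symD[OF sym_rtrancl[OF sym_Un_converse]])

lemma conn_trans: "(x, y) \<in> conn R \<Longrightarrow> (y, z) \<in> conn R \<Longrightarrow> (x, z) \<in> conn R"
  unfolding conn_def by (rule rtrancl_trans)

lemma conn_induct [consumes 1, case_names refl forward backward]:
  assumes "(x, y) \<in> conn R" "P x"
    and "\<And>y z. (x, y) \<in> conn R \<Longrightarrow> (y, z) \<in> R \<Longrightarrow> P y \<Longrightarrow> P z"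
    and "\<And>y z. (x, y) \<in> conn R \<Longrightarrow> (z, y) \<in> R \<Longrightarrow> P y \<Longrightarrow> P z"
  shows "P y"
  using assms unfolding conn_def by (induction rule: rtrancl_induct) auto

lemma conn_least:
  assumes "R \<subseteq> conn T"
  shows "conn R \<subseteq> conn T"
proof
  fix r assume "r \<in> conn R"
  then have "(fst r, snd r) \<in> conn R" by simp
  then have "(fst r, snd r) \<in> conn T"
    by (induction rule: conn_induct) (use assms in \<open>blast intro: conn_refl conn_trans conn_sym\<close>)+
  then show "r \<in> conn T" by simp
qed

lemma conn_mono: "R \<subseteq> T \<Longrightarrow> conn R \<subseteq> conn T"
  by (intro conn_least) (auto intro: conn_base)

lemma conn_class_eq_iff: "conn R `` {x} = conn R `` {y} \<longleftrightarrow> (x, y) \<in> conn R"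
  by (auto intro: conn_trans conn_sym)

lemma conn_insert_same:
  assumes "(a, b) \<in> conn R"
  shows "conn (insert (a, b) R) = conn R"
  using assms by (intro equalityI conn_least) (auto intro: conn_base)

text \<open>A path can be shortened so that it crosses the new link at most once, in one of the two
  directions.\<close>

lemma conn_insert_iff:
  "(x, y) \<in> conn (insert (a, b) R) \<longleftrightarrow>
    (x, y) \<in> conn R \<or> (x, a) \<in> conn R \<and> (b, y) \<in> conn R \<or> (x, b) \<in> conn R \<and> (a, y) \<in> conn R"
    (is "_ \<longleftrightarrow> ?P y")
proof
  have step: "?P z" if P: "?P y" and "(y, z) \<in> conn R \<or> y = a \<and> z = b \<or> y = b \<and> z = a" for y z
  proof -
    from that(2) consider "(y, z) \<in> conn R" | "y = a" "z = b" | "y = b" "z = a" by blast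
    then show ?thesis
    proof cases
      case 1
      with P show ?thesis by (meson conn_trans)
    qed (use P in auto)
  qed
  assume "(x, y) \<in> conn (insert (a, b) R)"
  then show "?P y"
  proof (induction rule: conn_induct)
    case (forward y z)
    then show ?case using step[of y z] conn_base[of "(y, z)" R] by blast
  next
    case (backward y z)
    then show ?case using step[of y z] conn_sym[OF conn_base[of "(z, y)" R]] by blast
  qed simp
next
  assume "?P y"
  moreover have "(u, v) \<in> conn (insert (a, b) R)" if "(u, v) \<in> conn R" for u v
    using that conn_mono[of R "insert (a, b) R"] by auto
  moreover have "(a, b) \<in> conn (insert (a, b) R)" by (simp add: conn_base)
  ultimately show "(x, y) \<in> conn (insert (a, b) R)"
    by (meson conn_sym conn_trans)
qed

text \<open>The classes of \<open>a\<close> and \<open>b\<close> merge and every other class stays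
  as it is; \<open>U\<close> collects the points of \<open>S\<close> in these other classes.\<close>

lemma card_blocks_insert:
  assumes "finite S" "a \<in> S" "b \<in> S" "(a, b) \<notin> conn R"
  shows "card (blocks S R) = Suc (card (blocks S (insert (a, b) R)))"
proof -
  define c where "c = (\<lambda>x. conn R `` {x})"
  define d where "d = (\<lambda>x. conn (insert (a, b) R) `` {x})"
  define U where "U = {x \<in> S. (x, a) \<notin> conn R \<and> (x, b) \<notin> conn R}"
  have c: "c x = c y \<longleftrightarrow> (x, y) \<in> conn R" for x y
    by (simp add: c_def conn_class_eq_iff)
  have d: "d x = d y \<longleftrightarrow> (x, y) \<in> conn (insert (a, b) R)" for x y
    by (simp add: d_def conn_class_eq_iff)
  have U: "U \<subseteq> S" by (auto simp: U_def)
  have "d x = c x" if "x \<in> U" for x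
    using that by (auto simp: U_def c_def d_def conn_insert_iff intro: conn_sym)
  then have "d ` U = c ` U" by simp
  moreover have "blocks S R = insert (c a) (insert (c b) (c ` U))"
  proof -
    have "\<forall>x \<in> S - U. c x = c a \<or> c x = c b" by (auto simp: c U_def)
    then have "c ` S = insert (c a) (insert (c b) (c ` U))" using assms(2,3) U by blast
    then show ?thesis by (simp add: blocks_def c_def)
  qed
  moreover have "blocks S (insert (a, b) R) = insert (d a) (d ` U)"
  proof -
    have "\<forall>x \<in> S - U. d x = d a" by (auto simp: d U_def conn_insert_iff)
    then have "d ` S = insert (d a) (d ` U)" using assms(2) U by blast
    then show ?thesis by (simp add: blocks_def d_def)
  qed
  moreover have "d a \<notin> d ` U"
    by (auto simp: U_def d conn_insert_iff dest: conn_sym)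
  moreover have "c a \<notin> insert (c b) (c ` U)" "c b \<notin> c ` U"
    using assms(4) by (auto simp: U_def c dest: conn_sym)
  moreover have "finite U" using assms(1) U by (rule rev_finite_subset)
  ultimately show ?thesis by simp
qed

lemma blocks_cong: "conn R = conn T \<Longrightarrow> blocks S R = blocks S T"
  by (simp add: blocks_def)

section \<open>Cycles and components as equivalence classes\<close>

lemma arrows_iff [simp]: "(x, y) \<in> arrows p \<longleftrightarrow> y = p x"
  by (simp add: arrows_def)

lemma conn_step: "arrows p \<subseteq> R \<Longrightarrow> (x, p x) \<in> conn R"
  by (intro conn_base) auto

text \<open>Orbits only run forward. A backward step is still possible because a permutation of
  finite support brings each point back to itself.\<close>

lemma orbit_conn:
  assumes "permutation p"
  shows "orbit p x = conn (arrows p) `` {x}"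
proof (intro equalityI subsetI)
  fix y assume "y \<in> orbit p x"
  then show "y \<in> conn (arrows p) `` {x}"
    by induction (auto intro: conn_step conn_trans)
next
  fix y assume "y \<in> conn (arrows p) `` {x}"
  then have "(x, y) \<in> conn (arrows p)" by simp
  then show "y \<in> orbit p x"
  proof (induction rule: conn_induct)
    case refl
    then show ?case by (rule permutation_self_in_orbit[OF assms])
  next
    case (forward y z)
    then show ?case by (auto intro: orbit.step)
  next
    case (backward y z)
    then have "z \<in> orbit p y"
      using permutation_orbit_step[OF assms, of z] permutation_self_in_orbit[OF assms, of z] by simp
    then show ?case using backward by (auto intro: orbit_trans)
  qed
qed

lemma permutes_permutation: "finite S \<Longrightarrow> p permutes S \<Longrightarrow> permutation p"
  unfolding permutation_permutes by blast

lemma cycles_blocks: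
  assumes "finite S" "p permutes S"
  shows "cycles S p = blocks S (arrows p)"
  using orbit_conn[OF permutes_permutation[OF assms]] by (simp add: cycles_def blocks_def)

text \<open>Words in the generators and their inverses trace out paths along arrows, an inverse
  being an arrow walked backward.\<close>

lemma generate_perm_conn:
  assumes "\<sigma> permutes S" "\<alpha> permutes S"
  shows "{g x | g. g \<in> generate (perm_group S) {\<sigma>, \<alpha>}} = conn (arrows \<sigma> \<union> arrows \<alpha>) `` {x}"
    (is "?L = ?R `` _")
proof (intro equalityI subsetI)
  have inv_step: "(y, perm_inv p y) \<in> ?R" if "p \<in> {\<sigma>, \<alpha>}" for p y
  proof -
    have "(perm_inv p y, p (perm_inv p y)) \<in> ?R"
      using that by (auto intro: conn_step)
    then show ?thesis using that assms by (auto simp: permutes_inverses intro: conn_sym)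
  qed
  fix y assume "y \<in> ?L"
  then obtain g where g: "g \<in> generate (perm_group S) {\<sigma>, \<alpha>}" and y: "y = g x" by blast
  from g have "(z, g z) \<in> ?R" for z
  proof (induction arbitrary: z rule: generate.induct)
    case one
    then show ?case by (simp add: perm_group_def)
  next
    case (incl h)
    then show ?case by (auto intro: conn_step)
  next
    case (inv h)
    then show ?case using inv_step[OF inv, of z] assms by (auto simp: inv_perm_group)
  next
    case (eng g h)
    then show ?case by (auto simp: perm_group_def intro: conn_trans)
  qed
  then show "y \<in> ?R `` {x}" by (simp add: y)
next
  fix y assume "y \<in> ?R `` {x}"
  then have "(x, y) \<in> ?R" by simp
  then show "y \<in> ?L"
  proof (induction rule: conn_induct)
    case refl
    have "id \<in> generate (perm_group S) {\<sigma>, \<alpha>}"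
      using generate.one[of "perm_group S"] by (simp add: perm_group_def)
    then show ?case by (intro CollectI exI[of _ id] conjI) (simp, assumption)
  next
    case (forward y z)
    then obtain g p where g: "g \<in> generate (perm_group S) {\<sigma>, \<alpha>}" "y = g x"
      and p: "p \<in> {\<sigma>, \<alpha>}" "z = p y" by auto
    have "p \<circ> g \<in> generate (perm_group S) {\<sigma>, \<alpha>}"
      using generate.eng[OF generate.incl[OF p(1), of "perm_group S"] g(1)] by (simp add: perm_group_def)
    then show ?case using g p by (intro CollectI exI[of _ "p \<circ> g"] conjI) (simp, assumption)
  next
    case (backward y z)
    then obtain g p where g: "g \<in> generate (perm_group S) {\<sigma>, \<alpha>}" "y = g x"
      and p: "p \<in> {\<sigma>, \<alpha>}" "y = p z" by auto
    have "perm_inv p \<circ> g \<in> generate (perm_group S) {\<sigma>, \<alpha>}"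
      using generate.eng[OF generate.inv[OF p(1), of "perm_group S"] g(1)] p(1) assms
      by (auto simp: perm_group_def inv_perm_group[unfolded perm_group_def])
    moreover have "z = perm_inv p y" using p assms by (auto simp: permutes_inverses)
    ultimately show ?case using g by (intro CollectI exI[of _ "perm_inv p \<circ> g"] conjI) (simp, assumption)
  qed
qed

lemma components_blocks:
  assumes "\<sigma> permutes S" "\<alpha> permutes S"
  shows "components S \<sigma> \<alpha> = blocks S (arrows \<sigma> \<union> arrows \<alpha>)"
  by (simp add: components_def blocks_def generate_perm_conn[OF assms])

lemma cycles_inv:
  assumes "finite S" "p permutes S"
  shows "cycles S (perm_inv p) = cycles S p"
  using orbit_inv_eq[OF permutes_permutation[OF assms]] by (simp add: cycles_def)

lemma num_cycles_inv:
  assumes "finite S" "p permutes S"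
  shows "num_cycles S (perm_inv p) = num_cycles S p"
  using cycles_inv[OF assms] by (simp add: num_cycles_def)

lemma num_cycles_id: "num_cycles S id = card S"
proof -
  have "orbit id x = {x}" for x :: 'a by (simp add: orbit_eq_singleton_iff)
  then show ?thesis by (simp add: num_cycles_def cycles_def card_image)
qed

section \<open>Multiplication by a transposition\<close>

lemma conn_swap:
  "conn (insert (a, b) (R \<union> arrows (p \<circ> swap a b))) = conn (insert (a, b) (R \<union> arrows p))"
proof -
  have *: "conn (insert (a, b) (R \<union> arrows (q \<circ> swap a b))) \<subseteq> conn (insert (a, b) (R \<union> arrows q))"
    for q
  proof (rule conn_least, rule subsetI)
    let ?C = "conn (insert (a, b) (R \<union> arrows q))"
    fix r assume "r \<in> insert (a, b) (R \<union> arrows (q \<circ> swap a b))"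
    moreover have "(x, q (swap a b x)) \<in> ?C" for x
    proof -
      have "(a, b) \<in> ?C" by (simp add: conn_base)
      then have "(x, swap a b x) \<in> ?C" by (auto simp: transpose_def intro: conn_sym)
      moreover have "(swap a b x, q (swap a b x)) \<in> ?C" by (intro conn_step) auto
      ultimately show ?thesis by (rule conn_trans)
    qed
    ultimately show "r \<in> ?C" by (cases r) (auto intro: conn_base)
  qed
  \<comment> \<open>A second multiplication by the swap restores \<open>p\<close>, so the one
    inclusion yields both.\<close>
  from *[of "p \<circ> swap a b"] *[of p] show ?thesis
    by (simp add: comp_assoc)
qed

text \<open>From \<open>a\<close> the new permutation jumps to \<open>p b\<close> and then follows
  the old cycle of \<open>b\<close>, which avoids \<open>a\<close>, until it arrives at
  \<open>b\<close>.\<close>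

lemma swap_joins:
  assumes "permutation p" "(a, b) \<notin> conn (arrows p)"
  shows "(a, b) \<in> conn (arrows (p \<circ> swap a b))"
proof -
  define q where "q = p \<circ> swap a b"
  have q: "q a = p b" "w \<noteq> a \<Longrightarrow> w \<noteq> b \<Longrightarrow> q w = p w" for w
    by (simp_all add: q_def)
  \<comment> \<open>The second alternative absorbs all steps after the walk has reached
    \<open>b\<close>, where \<open>q\<close> and \<open>p\<close> differ.\<close>
  have *: "(a, (p ^^ Suc i) b) \<in> conn (arrows q) \<or> (a, b) \<in> conn (arrows q)" for i
  proof (induction i)
    case 0
    show ?case using conn_step[of q "arrows q" a] by (simp add: q)
  next
    case (Suc i)
    define w where "w = (p ^^ Suc i) b"
    have pw: "(p ^^ Suc (Suc i)) b = p w" by (simp add: w_def)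
    have "w \<in> orbit p b" unfolding w_def orbit_altdef by blast
    then have "w \<noteq> a" using assms by (auto simp: orbit_conn intro: conn_sym)
    then have "w = b \<or> (w, p w) \<in> conn (arrows q)"
      using conn_step[of q "arrows q" w] q(2)[of w] by fastforce
    with Suc show ?case unfolding pw w_def[symmetric] by (auto intro: conn_trans)
  qed
  have "b \<in> orbit p b" by (rule permutation_self_in_orbit[OF assms(1)])
  then obtain n where "0 < n" "(p ^^ n) b = b" unfolding orbit_altdef by auto
  with *[of "n - 1"] show ?thesis by (simp add: q_def)
qed

text \<open>The new orbit of \<open>a\<close> is the arc from \<open>p b\<close> to \<open>a\<close>
  of the old cycle, and \<open>b\<close> is not on this arc.\<close>

lemma swap_splits:
  assumes "permutation p" "(a, b) \<in> conn (arrows p)" "a \<noteq> b"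
  shows "(a, b) \<notin> conn (arrows (p \<circ> swap a b))"
proof
  define q where "q = p \<circ> swap a b"
  have q: "q a = p b" "w \<noteq> a \<Longrightarrow> w \<noteq> b \<Longrightarrow> q w = p w" for w
    by (simp_all add: q_def)
  assume "(a, b) \<in> conn (arrows (p \<circ> swap a b))"
  moreover have "permutation q"
    unfolding q_def using assms(1) by (intro permutation_compose permutation_swap_id)
  ultimately have b: "b \<in> orbit q a" by (simp add: orbit_conn q_def)
  have "a \<in> orbit p b" using assms by (simp add: orbit_conn conn_sym)
  then have ex: "\<exists>n. 0 < n \<and> (p ^^ n) b = a" unfolding orbit_altdef by blast
  define k where "k = (LEAST n. 0 < n \<and> (p ^^ n) b = a)"
  have k: "0 < k" "(p ^^ k) b = a" using LeastI_ex[OF ex] by (simp_all add: k_def)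
  have min: "(p ^^ n) b \<noteq> a" if "0 < n" "n < k" for n
    using not_less_Least[of n "\<lambda>n. 0 < n \<and> (p ^^ n) b = a"] that unfolding k_def by blast
  \<comment> \<open>A return to \<open>b\<close> after \<open>n\<close> steps would make
    \<open>a\<close> appear already after \<open>k - n\<close> steps, against the minimality of
    \<open>k\<close>.\<close>
  have ne: "(p ^^ n) b \<noteq> b" if "0 < n" "n \<le> k" for n
  proof
    assume n: "(p ^^ n) b = b"
    have "(p ^^ (k - n)) ((p ^^ n) b) = (p ^^ (k - n + n)) b" by (simp add: funpow_add)
    then have "(p ^^ (k - n)) b = a" using n k(2) that(2) by simp
    moreover have "n \<noteq> k" using n k(2) assms(3) by blast
    ultimately show False using min[of "k - n"] that by simp
  qed
  \<comment> \<open>\<open>T\<close> is the arc; it is closed under \<open>q\<close>, which sends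
    its last point \<open>a\<close> back to its first point \<open>p b\<close>.\<close>
  define T where "T = {(p ^^ n) b | n. 0 < n \<and> n \<le> k}"
  have T: "(p ^^ n) b \<in> T" if "0 < n" "n \<le> k" for n using that unfolding T_def by blast
  have step: "q z \<in> T" if z: "z = a \<or> z \<in> T" for z
  proof (cases "z = a")
    case True
    then show ?thesis using T[of 1] k(1) by (simp add: q)
  next
    case False
    then obtain n where n: "z = (p ^^ n) b" "0 < n" "n \<le> k" using z unfolding T_def by blast
    then have "n \<noteq> k" "z \<noteq> b" using k(2) False ne by auto
    then have "q z = (p ^^ Suc n) b" using False n(1) by (simp add: q)
    then show ?thesis using T[of "Suc n"] n \<open>n \<noteq> k\<close> by simp
  qed
  from b have "b \<in> T" by induction (blast intro: step)+
  then obtain n where "b = (p ^^ n) b" "0 < n" "n \<le> k" unfolding T_def by blast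
  then show False using ne[of n] by simp
qed

lemma num_cycles_swap_join:
  assumes "finite S" "p permutes S" "a \<in> S" "b \<in> S" "(a, b) \<notin> conn (arrows p)"
  shows "num_cycles S p = Suc (num_cycles S (p \<circ> swap a b))"
proof -
  note perm = permutes_permutation[OF assms(1,2)]
  have "blocks S (insert (a, b) (arrows p)) = blocks S (arrows (p \<circ> swap a b))"
    using conn_swap[of a b "{}" p] conn_insert_same[OF swap_joins[OF perm assms(5)]]
    by (intro blocks_cong) simp
  moreover have "p \<circ> swap a b permutes S"
    using assms by (intro permutes_compose permutes_swap_id)
  ultimately show ?thesis
    using card_blocks_insert[OF assms(1,3-5)] assms(1,2) by (simp add: num_cycles_def cycles_blocks)
qed

text \<open>This is the joining case read backward: multiplying \<open>p \<circ> swap a b\<close> by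
  the swap gives \<open>p\<close> again.\<close>

lemma num_cycles_swap_split:
  assumes "finite S" "p permutes S" "a \<in> S" "b \<in> S" "(a, b) \<in> conn (arrows p)" "a \<noteq> b"
  shows "num_cycles S (p \<circ> swap a b) = Suc (num_cycles S p)"
proof -
  have "p \<circ> swap a b permutes S"
    using assms by (intro permutes_compose permutes_swap_id)
  from num_cycles_swap_join[OF assms(1) this assms(3,4)
      swap_splits[OF permutes_permutation[OF assms(1,2)] assms(5,6)]]
  show ?thesis by (simp add: comp_assoc)
qed


section \<open>The genus of a refinement\<close>

text \<open>Twice the genus, written with \<open>\<sigma>\<inverse>\<beta>\<close> instead of \<open>\<beta>\<inverse>\<sigma>\<close> so that a factor appended to \<open>\<beta>\<close> is
  appended to both permutations.\<close>

definition double_genus :: "'a set \<Rightarrow> ('a \<Rightarrow> 'a) \<Rightarrow> ('a \<Rightarrow> 'a) \<Rightarrow> int" where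
  "double_genus S \<sigma> \<beta> = int (card S) + 2 * int (num_components S \<sigma> \<beta>)
     - int (num_cycles S \<sigma>) - int (num_cycles S \<beta>) - int (num_cycles S (perm_inv \<sigma> \<circ> \<beta>))"

lemma inv_quotient:
  assumes "p permutes S" "q permutes S"
  shows "perm_inv (perm_inv p \<circ> q) = perm_inv q \<circ> p"
  using o_inv_distrib[OF permutes_bij[OF permutes_inv[OF assms(1)]] permutes_bij[OF assms(2)]]
  by (simp add: permutes_inv_inv[OF assms(1)])

lemma num_cycles_quotient_commute:
  assumes "finite S" "p permutes S" "q permutes S"
  shows "num_cycles S (perm_inv p \<circ> q) = num_cycles S (perm_inv q \<circ> p)"
  using num_cycles_inv[of S "perm_inv q \<circ> p"] inv_quotient[OF assms(3,2)] assms
  by (simp add: permutes_compose permutes_inv)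

text \<open>The number of cycles of \<beta> drops by one. If \<open>a\<close> and \<open>b\<close>
  share a component, \<kappa> is unchanged and the quotient gains or loses a cycle, for a total
  change of 0 or 2. Otherwise \<kappa> drops by one and the quotient loses a cycle, and everything
  cancels.\<close>

lemma double_genus_swap_join:
  assumes "finite S" "\<sigma> permutes S" "\<beta> permutes S" "a \<in> S" "b \<in> S"
    and nconn: "(a, b) \<notin> conn (arrows \<beta>)"
  shows "num_components S \<sigma> (\<beta> \<circ> swap a b) \<le> num_components S \<sigma> \<beta>"
    and "double_genus S \<sigma> (\<beta> \<circ> swap a b) \<in> {double_genus S \<sigma> \<beta>, double_genus S \<sigma> \<beta> + 2}"
proof -
  let ?R = "arrows \<sigma> \<union> arrows \<beta>" and ?\<beta>' = "\<beta> \<circ> swap a b"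
  have \<beta>': "?\<beta>' permutes S"
    using assms by (intro permutes_compose permutes_swap_id)
  have \<phi>: "perm_inv \<sigma> \<circ> \<beta> permutes S"
    using assms by (intro permutes_compose permutes_inv)
  note join = num_cycles_swap_join[OF assms(1,3-6)]
  have "(a, b) \<in> conn (arrows \<sigma> \<union> arrows ?\<beta>')"
    using swap_joins[OF permutes_permutation[OF assms(1,3)] nconn]
      conn_mono[of "arrows ?\<beta>'" "arrows \<sigma> \<union> arrows ?\<beta>'"] by blast
  then have "conn (arrows \<sigma> \<union> arrows ?\<beta>') = conn (insert (a, b) ?R)"
    using conn_swap[of a b "arrows \<sigma>" \<beta>] by (simp add: conn_insert_same)
  then have blocks: "blocks S (arrows \<sigma> \<union> arrows ?\<beta>') = blocks S (insert (a, b) ?R)"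
    by (rule blocks_cong)
  have "(x, perm_inv \<sigma> (\<beta> x)) \<in> conn ?R" for x
    using conn_step[of \<sigma> ?R "perm_inv \<sigma> (\<beta> x)"] conn_step[of \<beta> ?R x] assms(2)
    by (auto simp: permutes_inverses intro: conn_trans conn_sym)
  \<comment> \<open>Each cycle of the quotient lies in one component, so points in different
    components are in different cycles of it.\<close>
  then have sub: "conn (arrows (perm_inv \<sigma> \<circ> \<beta>)) \<subseteq> conn ?R"
    by (intro conn_least) auto
  have "num_components S \<sigma> ?\<beta>' \<le> num_components S \<sigma> \<beta> \<and>
    double_genus S \<sigma> ?\<beta>' \<in> {double_genus S \<sigma> \<beta>, double_genus S \<sigma> \<beta> + 2}"
  proof (cases "(a, b) \<in> conn ?R")
    case True
    then have "num_components S \<sigma> ?\<beta>' = num_components S \<sigma> \<beta>"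
      using blocks assms \<beta>'
      by (simp add: num_components_def components_blocks blocks_def conn_insert_same)
    moreover have "num_cycles S (perm_inv \<sigma> \<circ> \<beta>) = Suc (num_cycles S (perm_inv \<sigma> \<circ> ?\<beta>')) \<or>
      num_cycles S (perm_inv \<sigma> \<circ> ?\<beta>') = Suc (num_cycles S (perm_inv \<sigma> \<circ> \<beta>))"
    proof (cases "(a, b) \<in> conn (arrows (perm_inv \<sigma> \<circ> \<beta>))")
      case True
      moreover have "a \<noteq> b" using nconn by auto
      ultimately show ?thesis
        using num_cycles_swap_split[OF assms(1) \<phi> assms(4,5)] by (simp add: comp_assoc)
    next
      case False
      then show ?thesis
        using num_cycles_swap_join[OF assms(1) \<phi> assms(4,5)] by (simp add: comp_assoc)
    qed
    ultimately show ?thesis using join unfolding double_genus_def by auto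
  next
    case False
    then have "num_components S \<sigma> \<beta> = Suc (num_components S \<sigma> ?\<beta>')"
      using card_blocks_insert[OF assms(1,4,5) False] blocks assms \<beta>'
      by (simp add: num_components_def components_blocks)
    moreover have "num_cycles S (perm_inv \<sigma> \<circ> \<beta>) = Suc (num_cycles S (perm_inv \<sigma> \<circ> ?\<beta>'))"
      using num_cycles_swap_join[OF assms(1) \<phi> assms(4,5)] False sub by (auto simp: comp_assoc)
    ultimately show ?thesis using join unfolding double_genus_def by auto
  qed
  then show "num_components S \<sigma> ?\<beta>' \<le> num_components S \<sigma> \<beta>"
    "double_genus S \<sigma> ?\<beta>' \<in> {double_genus S \<sigma> \<beta>, double_genus S \<sigma> \<beta> + 2}" by blast+
qed

section \<open>Cycle counts of products and factorization into transpositions\<close>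

lemma num_cycles_le: "finite S \<Longrightarrow> num_cycles S p \<le> card S"
  unfolding num_cycles_def cycles_def by (rule card_image_le)

text \<open>The permutation \<open>r\<close> differs from \<open>p\<close> by splitting off
  \<open>p x\<close> as a fixed point. The transposition ends up on the left of \<open>r\<close>, so
  that in a product \<open>p \<circ> q\<close> a swap peeled off \<open>q\<close> can be handed to
  \<open>p\<close>.\<close>

lemma permutes_peel_swap:
  assumes "finite S" "p permutes S" "p \<noteq> id"
  obtains a b r where "a \<in> S" "b \<in> S" "a \<noteq> b" "r permutes S" "p = swap a b \<circ> r"
    "num_cycles S r = Suc (num_cycles S p)"
proof -
  obtain x where x: "p x \<noteq> x" using assms(3) by (auto simp: fun_eq_iff)
  define r where "r = p \<circ> swap x (p x)"
  have inj: "inj p" using assms(2) by (rule permutes_inj)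
  have S: "x \<in> S" "p x \<in> S" "p (p x) \<in> S"
    using x assms(2) by (auto simp: permutes_in_image dest: permutes_not_in)
  have r: "r permutes S"
    unfolding r_def using assms(2) S by (intro permutes_compose permutes_swap_id)
  \<comment> \<open>Moving the swap of \<open>x\<close> and \<open>p x\<close> across
    \<open>r\<close> replaces these points by their images under \<open>r\<close>, namely
    \<open>p (p x)\<close> and \<open>p x\<close>.\<close>
  have p: "p = swap (p x) (p (p x)) \<circ> r"
    by (auto simp: r_def fun_eq_iff transpose_def inj_eq[OF inj])
  have "num_cycles S r = Suc (num_cycles S p)"
    unfolding r_def using assms(1,2) S x
    by (intro num_cycles_swap_split) (auto intro: conn_step)
  with that[OF S(2,3) _ r p] x inj show ?thesis by (auto simp: inj_eq)
qed

text \<open>This is the triangle inequality for the length \<open>card S - num_cycles S p\<close>.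
  The induction hands one transposition after another from \<open>q\<close> to \<open>p\<close>,
  each costing \<open>p\<close> at most one cycle.\<close>

lemma num_cycles_comp_ge:
  assumes "finite S" "p permutes S" "q permutes S"
  shows "num_cycles S p + num_cycles S q \<le> card S + num_cycles S (p \<circ> q)"
  using assms(2,3)
proof (induction "card S - num_cycles S q" arbitrary: p q rule: less_induct)
  case less
  show ?case
  proof (cases "q = id")
    case True
    then show ?thesis by (simp add: num_cycles_id)
  next
    case False
    obtain a b r where r: "a \<in> S" "b \<in> S" "a \<noteq> b" "r permutes S" "q = swap a b \<circ> r"
      "num_cycles S r = Suc (num_cycles S q)"
      using permutes_peel_swap[OF assms(1) less.prems(2) False] by blast
    let ?p' = "p \<circ> swap a b"
    have "num_cycles S ?p' + num_cycles S r \<le> card S + num_cycles S (?p' \<circ> r)"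
    proof (rule less.hyps)
      show "card S - num_cycles S r < card S - num_cycles S q"
        using r(6) num_cycles_le[OF assms(1), of r] by simp
      show "?p' permutes S"
        using less.prems(1) r(1,2) by (intro permutes_compose permutes_swap_id)
    qed (rule r(4))
    moreover have "num_cycles S p \<le> Suc (num_cycles S ?p')"
      using num_cycles_swap_join[OF assms(1) less.prems(1) r(1,2)]
        num_cycles_swap_split[OF assms(1) less.prems(1) r(1,2) _ r(3)] by fastforce
    ultimately show ?thesis using r(5,6) by (simp add: comp_assoc)
  qed
qed

text \<open>If \<open>p \<circ> q\<close> attains the bound above, then writing \<open>q\<close> as a shortest product of transpositions
  leads from \<open>p\<close> to \<open>p \<circ> q\<close> by transpositions each of which joins two cycles.\<close>

lemma double_genus_mono:
  assumes "finite S" "\<sigma> permutes S" "p permutes S" "q permutes S"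
    and "num_cycles S p + num_cycles S q = card S + num_cycles S (p \<circ> q)"
  shows "double_genus S \<sigma> p \<le> double_genus S \<sigma> (p \<circ> q) \<and>
    even (double_genus S \<sigma> (p \<circ> q) - double_genus S \<sigma> p) \<and>
    num_components S \<sigma> (p \<circ> q) \<le> num_components S \<sigma> p"
  using assms(3-5)
proof (induction "card S - num_cycles S q" arbitrary: p q rule: less_induct)
  case less
  show ?case
  proof (cases "q = id")
    case False
    obtain a b r where r: "a \<in> S" "b \<in> S" "a \<noteq> b" "r permutes S" "q = swap a b \<circ> r"
      "num_cycles S r = Suc (num_cycles S q)"
      using permutes_peel_swap[OF assms(1) less.prems(2) False] by blast
    let ?p' = "p \<circ> swap a b"
    have p': "?p' permutes S"
      using less.prems(1) r(1,2) by (intro permutes_compose permutes_swap_id)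
    have eq: "?p' \<circ> r = p \<circ> q" using r(5) by (simp add: comp_assoc)
    \<comment> \<open>A splitting swap would raise both cycle counts on the left by one without
      changing the product, exceeding the bound that is already attained.\<close>
    have nconn: "(a, b) \<notin> conn (arrows p)"
    proof
      assume "(a, b) \<in> conn (arrows p)"
      then have "num_cycles S ?p' = Suc (num_cycles S p)"
        by (intro num_cycles_swap_split[OF assms(1) less.prems(1) r(1,2) _ r(3)])
      then show False
        using num_cycles_comp_ge[OF assms(1) p' r(4)] r(6) less.prems(3) unfolding eq by simp
    qed
    note join = num_cycles_swap_join[OF assms(1) less.prems(1) r(1,2) nconn]
    have "card S - num_cycles S r < card S - num_cycles S q"
      using r(6) num_cycles_le[OF assms(1), of r] by simp
    from less.hyps[OF this p' r(4)] have IH: "double_genus S \<sigma> ?p' \<le> double_genus S \<sigma> (p \<circ> q)"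
      "even (double_genus S \<sigma> (p \<circ> q) - double_genus S \<sigma> ?p')"
      "num_components S \<sigma> (p \<circ> q) \<le> num_components S \<sigma> ?p'"
      using join r(6) less.prems(3) unfolding eq by auto
    show ?thesis
      using IH double_genus_swap_join[OF assms(1,2) less.prems(1) r(1,2) nconn] by auto
  qed simp
qed

lemma double_genus_id:
  assumes "finite S" "\<sigma> permutes S"
  shows "double_genus S \<sigma> id = 0"
proof -
  have "conn (arrows \<sigma> \<union> arrows id) = conn (arrows \<sigma>)"
    by (intro equalityI conn_least) (auto intro: conn_base)
  then have "num_components S \<sigma> id = num_cycles S \<sigma>"
    using assms by (simp add: num_components_def components_blocks permutes_id num_cycles_def
        cycles_blocks blocks_def)
  then show ?thesis using assms by (simp add: double_genus_def num_cycles_id num_cycles_inv)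
qed

text \<open>Since the identity has \<open>card S\<close> cycles, \<open>id \<circ> \<alpha>\<close>
  attains the bound, so \<alpha> is reached by joins from double genus 0.\<close>

lemma double_genus_nonneg_even:
  assumes "finite S" "\<sigma> permutes S" "\<alpha> permutes S"
  shows "0 \<le> double_genus S \<sigma> \<alpha>" "even (double_genus S \<sigma> \<alpha>)"
  using double_genus_mono[OF assms(1,2) permutes_id assms(3)] double_genus_id[OF assms(1,2)]
  by (simp_all add: num_cycles_id)

section \<open>Restriction to invariant subsets\<close>

lemma perm_restrict_permutes:
  assumes "finite C" "p permutes S" "\<And>x. x \<in> C \<Longrightarrow> p x \<in> C"
  shows "perm_restrict p C permutes C"
proof (rule bij_imp_permutes)
  have "p ` C = C"
    using assms by (intro endo_inj_surj) (auto intro: inj_on_subset[OF permutes_inj])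
  then show "bij_betw (perm_restrict p C) C C"
    using permutes_inj_on[OF assms(2), of C]
    by (auto simp: bij_betw_def perm_restrict_def inj_on_def image_def)
qed (simp add: perm_restrict_def)

lemma perm_restrict_quotient:
  assumes "p permutes S" "perm_restrict p C permutes C" "\<And>x. x \<in> C \<Longrightarrow> q x \<in> C"
  shows "perm_inv (perm_restrict p C) \<circ> perm_restrict q C = perm_restrict (perm_inv p \<circ> q) C"
proof
  fix x
  show "(perm_inv (perm_restrict p C) \<circ> perm_restrict q C) x = perm_restrict (perm_inv p \<circ> q) C x"
  proof (cases "x \<in> C")
    case True
    define y where "y = perm_inv (perm_restrict p C) (q x)"
    have "y \<in> C"
      unfolding y_def using assms(2,3) True by (simp add: permutes_in_image[OF permutes_inv])
    moreover have "perm_restrict p C y = q x"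
      unfolding y_def using assms(2) by (simp add: permutes_inverses)
    ultimately have "perm_inv p (q x) = y"
      using assms(1) permutes_inverses(2)[OF assms(1), of y] by (simp add: perm_restrict_simps)
    then show ?thesis using True by (simp add: perm_restrict_simps y_def)
  next
    case False
    then show ?thesis
      using permutes_not_in[OF permutes_inv[OF assms(2)]] by (simp add: perm_restrict_simps)
  qed
qed

lemma perm_restrict_closed:
  assumes "perm_restrict p C permutes C" "x \<in> C"
  shows "p x \<in> C"
  using permutes_in_image[OF assms(1), of x] assms(2) by (simp add: perm_restrict_simps)

text \<open>With \<open>id\<close> as second factor, \<open>perm_restrict_quotient\<close> says that
  on \<open>C\<close> the inverse of \<open>p\<close> agrees with the inverse of its
  restriction.\<close>

lemma perm_restrict_closed_inv:
  assumes "p permutes S" "perm_restrict p C permutes C" "x \<in> C"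
  shows "perm_inv p x \<in> C"
  using perm_restrict_quotient[OF assms(1,2), of id, THEN fun_cong, of x]
    permutes_in_image[OF permutes_inv[OF assms(2)], of x] assms(3)
  by (simp add: perm_restrict_simps)

text \<open>Every orbit stays in the part where it starts and is also an orbit of the restriction;
  being nonempty, orbits from disjoint parts are distinct.\<close>

lemma num_cycles_restrict_sum:
  assumes "finite S" "\<Union>P = S" "disjoint P" "\<And>C x. C \<in> P \<Longrightarrow> x \<in> C \<Longrightarrow> p x \<in> C"
  shows "num_cycles S p = (\<Sum>C\<in>P. num_cycles C (perm_restrict p C))"
proof -
  have orbit: "orbit p x \<subseteq> C" if "C \<in> P" "x \<in> C" for C x
  proof
    fix y assume "y \<in> orbit p x"
    then show "y \<in> C" by induction (use assms(4) that in blast)+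
  qed
  have fin: "finite P" "\<forall>C\<in>P. finite C"
    using assms(1,2) by (auto intro: finite_UnionD rev_finite_subset)
  have "cycles C (perm_restrict p C) = orbit p ` C" if "C \<in> P" for C
    unfolding cycles_def using assms(4) that
    by (intro image_cong refl orbit_cong0[of _ C]) (auto simp: perm_restrict_simps)
  then have "(\<Sum>C\<in>P. num_cycles C (perm_restrict p C)) = (\<Sum>C\<in>P. card (orbit p ` C))"
    by (simp add: num_cycles_def)
  also have "\<dots> = card (\<Union>C\<in>P. orbit p ` C)"
  proof (rule card_UN_disjoint[symmetric])
    show "\<forall>C\<in>P. \<forall>D\<in>P. C \<noteq> D \<longrightarrow> orbit p ` C \<inter> orbit p ` D = {}"
    proof (intro ballI impI)
      fix C D assume "C \<in> P" "D \<in> P" "C \<noteq> D"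
      then have "C \<inter> D = {}" using assms(3) by (auto simp: disjoint_def)
      moreover have "orbit p x \<noteq> orbit p y" if "x \<in> C" "y \<in> D" for x y
        using calculation orbit[OF \<open>C \<in> P\<close> that(1)] orbit[OF \<open>D \<in> P\<close> that(2)]
          orbit_nonempty[of p x] by blast
      ultimately show "orbit p ` C \<inter> orbit p ` D = {}" by blast
    qed
  qed (use fin in auto)
  also have "(\<Union>C\<in>P. orbit p ` C) = cycles S p"
    unfolding cycles_def using assms(2) by blast
  finally show ?thesis by (simp add: num_cycles_def)
qed

section \<open>Decomposition into connected components\<close>

lemma blocks_disjoint: "disjoint (blocks S R)"
proof (rule disjointI)
  fix C D assume "C \<in> blocks S R" "D \<in> blocks S R" "C \<noteq> D"
  then obtain x y where xy: "C = conn R `` {x}" "D = conn R `` {y}" by (auto simp: blocks_def)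
  show "C \<inter> D = {}"
  proof (rule ccontr)
    assume "C \<inter> D \<noteq> {}"
    then obtain z where "(x, z) \<in> conn R" "(y, z) \<in> conn R" using xy by auto
    then show False using \<open>C \<noteq> D\<close> xy conn_class_eq_iff conn_sym conn_trans by metis
  qed
qed

lemma Union_blocks:
  assumes "\<And>x y. (x, y) \<in> R \<Longrightarrow> x \<in> S \<longleftrightarrow> y \<in> S"
  shows "\<Union>(blocks S R) = S"
proof -
  have "y \<in> S" if "(x, y) \<in> conn R" "x \<in> S" for x y
    using that by (induction rule: conn_induct) (auto simp: assms)
  then show ?thesis by (auto simp: blocks_def)
qed

lemma blocks_closed:
  assumes "C \<in> blocks S R" "x \<in> C" "(x, y) \<in> conn R"
  shows "y \<in> C"
  using assms by (auto simp: blocks_def intro: conn_trans)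

lemma blocks_connected:
  assumes "C \<in> blocks S R" "x \<in> C" "y \<in> C"
  shows "(x, y) \<in> conn R"
  using assms by (auto simp: blocks_def intro: conn_trans conn_sym)

text \<open>A path that starts in \<open>C\<close> never leaves it, so it uses only arrows of the
  restrictions. Each component is thus a hypermap by itself.\<close>

lemma num_components_restrict:
  assumes "finite S" "\<sigma> permutes S" "\<alpha> permutes S" "C \<in> blocks S (arrows \<sigma> \<union> arrows \<alpha>)"
    and "perm_restrict \<sigma> C permutes C" "perm_restrict \<alpha> C permutes C"
  shows "num_components C (perm_restrict \<sigma> C) (perm_restrict \<alpha> C) = 1"
proof -
  let ?R = "arrows \<sigma> \<union> arrows \<alpha>" and ?T = "arrows (perm_restrict \<sigma> C) \<union> arrows (perm_restrict \<alpha> C)"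
  have "conn ?T `` {x} = C" if x: "x \<in> C" for x
  proof (intro equalityI subsetI)
    fix y assume "y \<in> conn ?T `` {x}"
    then have "(x, y) \<in> conn ?T" by simp
    then show "y \<in> C"
    proof (induction rule: conn_induct)
      case (forward y z)
      then show ?case using permutes_in_image[OF assms(5), of y] permutes_in_image[OF assms(6), of y] by auto
    next
      case (backward y z)
      then show ?case using permutes_in_image[OF assms(5), of z] permutes_in_image[OF assms(6), of z] by auto
    qed (rule x)
  next
    fix y assume "y \<in> C"
    then have "(x, y) \<in> conn ?R" using blocks_connected[OF assms(4) x] by blast
    then have "(x, y) \<in> conn ?T"
    proof (induction rule: conn_induct)
      case (forward y z)
      then have "y \<in> C" using blocks_closed[OF assms(4) x] by blast
      then have "(y, z) \<in> conn ?T"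
        using forward(2) by (auto simp: perm_restrict_simps intro!: conn_base)
      with forward(3) show ?case by (rule conn_trans)
    next
      case (backward y z)
      then have "z \<in> C"
        using blocks_closed[OF assms(4) x, of z] conn_sym[OF conn_base[OF backward(2)]] conn_trans by metis
      then have "(z, y) \<in> conn ?T"
        using backward(2) by (auto simp: perm_restrict_simps intro!: conn_base)
      with backward(3) show ?case by (blast intro: conn_trans conn_sym)
    qed simp
    then show "y \<in> conn ?T `` {x}" by simp
  qed
  moreover have "C \<noteq> {}" using assms(4) conn_refl[of _ ?R] unfolding blocks_def by blast
  ultimately have "blocks C ?T = {C}" by (auto simp: blocks_def)
  then show ?thesis using assms(5,6) by (simp add: num_components_def components_blocks)
qed

text \<open>The double genus is additive over components. A vanishing sum of natural numbers makes
  every component have genus zero.\<close>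

lemma double_genus_eq_0:
  assumes "finite S" "\<sigma> permutes S" "\<alpha> permutes S" "genus S \<sigma> \<alpha> = 0"
  shows "double_genus S \<sigma> \<alpha> = 0"
proof -
  let ?R = "arrows \<sigma> \<union> arrows \<alpha>" and ?\<phi> = "perm_inv \<sigma> \<circ> \<alpha>"
  define P where "P = components S \<sigma> \<alpha>"
  have P: "P = blocks S ?R" unfolding P_def using assms(2,3) by (rule components_blocks)
  have un: "\<Union>P = S"
    unfolding P using assms(2,3) by (intro Union_blocks) (auto simp: permutes_in_image)
  have dis: "disjoint P" unfolding P by (rule blocks_disjoint)
  have fin: "finite P" "\<And>C. C \<in> P \<Longrightarrow> finite C"
    using assms(1) un by (auto intro: finite_UnionD rev_finite_subset)
  have closed: "\<sigma> x \<in> C" "\<alpha> x \<in> C" if "C \<in> P" "x \<in> C" for C x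
    using that unfolding P by (auto intro: blocks_closed conn_step)
  have restrict: "perm_restrict \<sigma> C permutes C" "perm_restrict \<alpha> C permutes C" if "C \<in> P" for C
    using that closed fin(2) assms(2,3) by (auto intro: perm_restrict_permutes)
  have \<phi>: "perm_inv (perm_restrict \<sigma> C) \<circ> perm_restrict \<alpha> C = perm_restrict ?\<phi> C" if "C \<in> P" for C
    using that closed by (intro perm_restrict_quotient[OF assms(2) restrict(1)])
  have dg: "double_genus C (perm_restrict \<sigma> C) (perm_restrict \<alpha> C) = int (card C) + 2
      - int (num_cycles C (perm_restrict \<sigma> C)) - int (num_cycles C (perm_restrict \<alpha> C))
      - int (num_cycles C (perm_restrict ?\<phi> C))" if "C \<in> P" for C
    using num_components_restrict[OF assms(1-3) _ restrict] that \<phi>[OF that]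
    unfolding double_genus_def P by simp
  have zero: "double_genus C (perm_restrict \<sigma> C) (perm_restrict \<alpha> C) = 0" if "C \<in> P" for C
  proof -
    let ?\<sigma> = "perm_restrict \<sigma> C" and ?\<alpha> = "perm_restrict \<alpha> C"
    \<comment> \<open>\<open>hypermap_genus\<close> counts the cycles of the inverse of the quotient
      that occurs in \<open>double_genus\<close>.\<close>
    have eq: "num_cycles C (perm_inv ?\<alpha> \<circ> ?\<sigma>) = num_cycles C (perm_restrict ?\<phi> C)"
      using num_cycles_quotient_commute[OF fin(2) restrict(2,1)] that \<phi> by simp
    \<comment> \<open>The definite description in \<open>hypermap_genus\<close> is meaningful only
      if some natural number solves its equation; nonnegativity and evenness supply one.\<close>
    have "double_genus C ?\<sigma> ?\<alpha> = 2 * int (nat (double_genus C ?\<sigma> ?\<alpha> div 2))"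
      using double_genus_nonneg_even[OF fin(2) restrict] that by simp
    then obtain g where g: "double_genus C ?\<sigma> ?\<alpha> = 2 * int g" ..
    have "hypermap_genus C ?\<sigma> ?\<alpha> = g"
      unfolding hypermap_genus_def eq using g dg[OF that] by (intro the_equality) auto
    moreover have "hypermap_genus C ?\<sigma> ?\<alpha> = 0"
      using assms(4) fin(1) that by (auto simp: genus_def P_def)
    ultimately show ?thesis using g by simp
  qed
  have "card S = (\<Sum>C\<in>P. card C)"
    using card_Union_disjoint[of P] dis fin(2) un by (simp add: disjoint_def pairwise_def disjnt_def)
  \<comment> \<open>Counting components as a sum of ones puts the constant 2 into each
    summand.\<close>
  moreover have "num_components S \<sigma> \<alpha> = (\<Sum>C\<in>P. 1)" by (simp add: num_components_def P_def)
  moreover have "num_cycles S p = (\<Sum>C\<in>P. num_cycles C (perm_restrict p C))" if "p \<in> {\<sigma>, \<alpha>, ?\<phi>}" for p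
    using that closed perm_restrict_closed_inv[OF assms(2) restrict(1)]
    by (intro num_cycles_restrict_sum[OF assms(1) un dis]) auto
  ultimately have "double_genus S \<sigma> \<alpha> = (\<Sum>C\<in>P. int (card C) + 2
      - int (num_cycles C (perm_restrict \<sigma> C)) - int (num_cycles C (perm_restrict \<alpha> C))
      - int (num_cycles C (perm_restrict ?\<phi> C)))"
    by (simp add: double_genus_def sum.distrib sum_subtractf)
  also have "\<dots> = 0" using dg zero by (intro sum.neutral) auto
  finally show ?thesis .
qed

section \<open>Refinements\<close>

lemma cycles_partition:
  assumes "finite S" "\<alpha> permutes S"
  shows "\<Union>(cycles S \<alpha>) = S" "disjoint (cycles S \<alpha>)"
    and "C \<in> cycles S \<alpha> \<Longrightarrow> finite C" "C \<in> cycles S \<alpha> \<Longrightarrow> perm_restrict \<alpha> C permutes C"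
proof -
  note cyc = cycles_blocks[OF assms]
  show un: "\<Union>(cycles S \<alpha>) = S"
    unfolding cyc using assms(2) by (intro Union_blocks) (auto simp: permutes_in_image)
  show "disjoint (cycles S \<alpha>)" unfolding cyc by (rule blocks_disjoint)
  show fin: "finite C" if "C \<in> cycles S \<alpha>" using that un assms(1) by (auto intro: rev_finite_subset)
  show "perm_restrict \<alpha> C permutes C" if "C \<in> cycles S \<alpha>"
    using that fin assms(2) unfolding cyc
    by (intro perm_restrict_permutes) (auto intro: blocks_closed conn_step)
qed

text \<open>The genus equations of the single cycles add up, the ones on their right sides counting
  the cycles of \<alpha>. The result is the equality case of \<open>num_cycles_comp_ge\<close> for
  the factorization of \<alpha> through \<beta>.\<close>

lemma perm_refines_num_cycles:
  assumes "finite S" "\<alpha> permutes S" "perm_refines S \<beta> \<alpha>"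
  shows "num_cycles S \<beta> + num_cycles S (perm_inv \<beta> \<circ> \<alpha>) = card S + num_cycles S \<alpha>"
proof -
  note part = cycles_partition[OF assms(1,2)]
  have \<beta>: "\<beta> permutes S" using assms(3) by (simp add: perm_refines_def)
  have C: "perm_restrict \<beta> C permutes C" "num_cycles C (perm_restrict \<beta> C) +
      num_cycles C (perm_inv (perm_restrict \<beta> C) \<circ> perm_restrict \<alpha> C) = card C + 1"
    if "C \<in> cycles S \<alpha>" for C
    using assms(3) that by (auto simp: perm_refines_def)
  have closed: "\<alpha> x \<in> C" "\<beta> x \<in> C" "perm_inv \<beta> x \<in> C" if "C \<in> cycles S \<alpha>" "x \<in> C" for C x
    using perm_restrict_closed[OF part(4)] perm_restrict_closed[OF C(1)]
      perm_restrict_closed_inv[OF \<beta> C(1)] that by blast+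
  have "num_cycles S \<beta> + num_cycles S (perm_inv \<beta> \<circ> \<alpha>) = (\<Sum>C\<in>cycles S \<alpha>.
      num_cycles C (perm_restrict \<beta> C) + num_cycles C (perm_restrict (perm_inv \<beta> \<circ> \<alpha>) C))"
    using closed num_cycles_restrict_sum[OF assms(1) part(1,2)] by (simp add: sum.distrib)
  also have "\<dots> = (\<Sum>C\<in>cycles S \<alpha>. card C + 1)"
    using C closed perm_restrict_quotient[OF \<beta>] by (intro sum.cong) auto
  also have "\<dots> = card S + num_cycles S \<alpha>"
    using card_Union_disjoint[of "cycles S \<alpha>"] part
    by (simp add: sum_Suc num_cycles_def disjoint_def pairwise_def disjnt_def)
  finally show ?thesis .
qed

text \<open>As sets, \<alpha> and its inverse have the same cycles. On each of them the two cycle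
  counts in the genus equation trade places, up to inverting the permutations.\<close>

lemma perm_refines_dual:
  assumes "finite S" "\<alpha> permutes S" "perm_refines S \<beta> \<alpha>"
  shows "perm_refines S (perm_inv \<alpha> \<circ> \<beta>) (perm_inv \<alpha>)"
proof -
  have \<beta>: "\<beta> permutes S" using assms(3) by (simp add: perm_refines_def)
  have \<gamma>: "perm_inv \<alpha> \<circ> \<beta> permutes S" using assms(2) \<beta> by (intro permutes_compose permutes_inv)
  note cycles_inv[OF assms(1,2)]
  moreover have "perm_restrict (perm_inv \<alpha> \<circ> \<beta>) C permutes C \<and>
    num_cycles C (perm_restrict (perm_inv \<alpha> \<circ> \<beta>) C) +
    num_cycles C (perm_inv (perm_restrict (perm_inv \<alpha> \<circ> \<beta>) C) \<circ> perm_restrict (perm_inv \<alpha>) C) = card C + 1"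
    if "C \<in> cycles S \<alpha>" for C
  proof -
    let ?\<alpha> = "perm_restrict \<alpha> C" and ?\<beta> = "perm_restrict \<beta> C"
    have fin: "finite C" and \<alpha>C: "?\<alpha> permutes C" using cycles_partition[OF assms(1,2)] that by auto
    have \<beta>C: "?\<beta> permutes C" and z: "num_cycles C ?\<beta> + num_cycles C (perm_inv ?\<beta> \<circ> ?\<alpha>) = card C + 1"
      using assms(3) that by (auto simp: perm_refines_def)
    have \<gamma>C: "perm_restrict (perm_inv \<alpha> \<circ> \<beta>) C = perm_inv ?\<alpha> \<circ> ?\<beta>"
      using perm_restrict_quotient[OF assms(2) \<alpha>C] perm_restrict_closed[OF \<beta>C] by metis
    have \<alpha>'C: "perm_restrict (perm_inv \<alpha>) C = perm_inv ?\<alpha>"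
      using perm_restrict_quotient[OF assms(2) \<alpha>C, of id] by (simp add: perm_restrict_def[of id] id_def[symmetric])
    have "perm_inv (perm_inv ?\<alpha> \<circ> ?\<beta>) \<circ> perm_inv ?\<alpha> = perm_inv ?\<beta>"
      using inv_quotient[OF \<alpha>C \<beta>C] permutes_inv_o(1)[OF \<alpha>C] by (simp add: comp_assoc)
    then show ?thesis
      using z \<alpha>C \<beta>C fin num_cycles_quotient_commute[OF fin \<alpha>C \<beta>C] num_cycles_inv[OF fin \<beta>C]
      unfolding \<gamma>C \<alpha>'C by (simp add: permutes_compose permutes_inv)
  qed
  ultimately show ?thesis using \<gamma> by (simp add: perm_refines_def)
qed

text \<open>Monotonicity squeezes the double genus of \<beta> between 0 and that of \<alpha>. The
  inequality for components later excludes truncated subtraction in the exponents.\<close>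

lemma perm_refines_genus_0:
  assumes "finite S" "\<sigma> permutes S" "\<alpha> permutes S" "double_genus S \<sigma> \<alpha> = 0" "perm_refines S \<beta> \<alpha>"
  shows "double_genus S \<sigma> \<beta> = 0" "num_components S \<sigma> \<alpha> \<le> num_components S \<sigma> \<beta>"
proof -
  have \<beta>: "\<beta> permutes S" using assms(5) by (simp add: perm_refines_def)
  have \<delta>: "perm_inv \<beta> \<circ> \<alpha> permutes S" using assms(3) \<beta> by (intro permutes_compose permutes_inv)
  have "\<beta> \<circ> (perm_inv \<beta> \<circ> \<alpha>) = \<alpha>"
    using permutes_inv_o(1)[OF \<beta>] by (simp flip: comp_assoc)
  with double_genus_mono[OF assms(1,2) \<beta> \<delta>] perm_refines_num_cycles[OF assms(1,3,5)]
    double_genus_nonneg_even(1)[OF assms(1,2) \<beta>] assms(4)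
  show "double_genus S \<sigma> \<beta> = 0" "num_components S \<sigma> \<alpha> \<le> num_components S \<sigma> \<beta>" by auto
qed

section \<open>Duality and the exchange of exponents\<close>

lemma num_components_dual:
  assumes "\<sigma> permutes S" "\<alpha> permutes S"
  shows "num_components S (perm_inv \<alpha> \<circ> \<sigma>) (perm_inv \<alpha>) = num_components S \<sigma> \<alpha>"
proof -
  let ?R = "arrows \<sigma> \<union> arrows \<alpha>" and ?T = "arrows (perm_inv \<alpha> \<circ> \<sigma>) \<union> arrows (perm_inv \<alpha>)"
  have inv: "(x, perm_inv \<alpha> x) \<in> conn ?R" for x
    using conn_sym[OF conn_step[of \<alpha> ?R "perm_inv \<alpha> x"]] assms(2) by (simp add: permutes_inverses)
  have "conn ?T \<subseteq> conn ?R"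
  proof (rule conn_least)
    have "(x, perm_inv \<alpha> (\<sigma> x)) \<in> conn ?R" for x
      using conn_step[of \<sigma> ?R x] inv[of "\<sigma> x"] by (auto intro: conn_trans)
    then show "?T \<subseteq> conn ?R" using inv by auto
  qed
  moreover have "conn ?R \<subseteq> conn ?T"
  proof (rule conn_least)
    have "(x, \<alpha> x) \<in> conn ?T" for x
      using conn_sym[OF conn_step[of "perm_inv \<alpha>" ?T "\<alpha> x"]] assms(2) by (simp add: permutes_inverses)
    moreover have "(x, \<sigma> x) \<in> conn ?T" for x
      using conn_step[of "perm_inv \<alpha> \<circ> \<sigma>" ?T x] conn_sym[OF conn_step[of "perm_inv \<alpha>" ?T "\<sigma> x"]]
      by (auto intro: conn_trans)
    ultimately show "?R \<subseteq> conn ?T" by auto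
  qed
  ultimately have "conn ?T = conn ?R" by blast
  then have "blocks S ?T = blocks S ?R" by (rule blocks_cong)
  then show ?thesis
    using assms by (simp add: num_components_def components_blocks permutes_compose permutes_inv)
qed

lemma perm_refines_dual_exponents:
  assumes "finite S" "\<sigma> permutes S" "\<alpha> permutes S" "double_genus S \<sigma> \<alpha> = 0" "perm_refines S \<beta> \<alpha>"
  defines "\<sigma>' \<equiv> perm_inv \<alpha> \<circ> \<sigma>" and "\<beta>' \<equiv> perm_inv \<alpha> \<circ> \<beta>"
  shows "num_components S \<sigma> \<beta> - num_components S \<sigma> \<alpha> =
      num_components S \<sigma>' \<beta>' + card S - num_cycles S \<beta>' - num_cycles S \<sigma>'"
    and "num_components S \<sigma> \<beta> + card S - num_cycles S \<beta> - num_cycles S \<sigma> =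
      num_components S \<sigma>' \<beta>' - num_components S \<sigma>' (perm_inv \<alpha>)"
proof -
  have \<beta>: "\<beta> permutes S" using assms(5) by (simp add: perm_refines_def)
  have perm: "perm_inv \<alpha> permutes S" "\<sigma>' permutes S"
    unfolding \<sigma>'_def using assms(2,3) by (auto intro: permutes_compose permutes_inv)
  note \<kappa> = num_components_dual[OF assms(2,3), folded \<sigma>'_def]
  have \<sigma>'_inv: "perm_inv \<sigma>' = perm_inv \<sigma> \<circ> \<alpha>"
    unfolding \<sigma>'_def using assms(2,3) by (rule inv_quotient[rotated])
  have cancel: "\<alpha> \<circ> (perm_inv \<alpha> \<circ> p) = p" for p :: "'a \<Rightarrow> 'a"
    using permutes_inv_o(1)[OF assms(3)] by (simp flip: comp_assoc)
  \<comment> \<open>The first quotient shows that the dual pair has the cycle counts of the original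
    triple in another order; the second that \<beta> and \<beta>' share the third
    permutation.\<close>
  have quot: "perm_inv \<sigma>' \<circ> perm_inv \<alpha> = perm_inv \<sigma>" "perm_inv \<sigma>' \<circ> \<beta>' = perm_inv \<sigma> \<circ> \<beta>"
    unfolding \<sigma>'_inv \<beta>'_def using permutes_inv_o(1)[OF assms(3)] cancel[of \<beta>]
    by (simp_all add: comp_assoc)
  have z: "num_cycles S (perm_inv \<sigma> \<circ> \<alpha>) = num_cycles S \<sigma>'"
    unfolding \<sigma>'_def using assms by (intro num_cycles_quotient_commute)
  have dual: "double_genus S \<sigma>' (perm_inv \<alpha>) = 0"
    using assms(1-4) \<kappa> z unfolding double_genus_def quot by (simp add: num_cycles_inv)
  have geodesic: "num_cycles S \<beta> + num_cycles S \<beta>' = card S + num_cycles S \<alpha>"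
    using perm_refines_num_cycles[OF assms(1,3,5)] num_cycles_quotient_commute[OF assms(1,3) \<beta>]
    unfolding \<beta>'_def by simp
  note primal = perm_refines_genus_0[OF assms(1-5)]
  note dual' = perm_refines_genus_0[OF assms(1) perm(2,1) dual
      perm_refines_dual[OF assms(1,3,5)], folded \<beta>'_def]
  have "num_components S \<sigma> \<beta> + num_components S \<sigma>' \<beta>' =
      num_components S \<sigma> \<alpha> + num_cycles S (perm_inv \<sigma> \<circ> \<beta>)"
    using primal(1) dual'(1) assms(4) geodesic z unfolding double_genus_def quot by linarith
  \<comment> \<open>By the component inequalities in \<open>primal\<close> and \<open>dual'\<close>,
    both differences of component numbers are true differences.\<close>
  then show "num_components S \<sigma> \<beta> - num_components S \<sigma> \<alpha> =
      num_components S \<sigma>' \<beta>' + card S - num_cycles S \<beta>' - num_cycles S \<sigma>'"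
    and "num_components S \<sigma> \<beta> + card S - num_cycles S \<beta> - num_cycles S \<sigma> =
      num_components S \<sigma>' \<beta>' - num_components S \<sigma>' (perm_inv \<alpha>)"
    using primal dual' \<kappa> unfolding double_genus_def quot by linarith+
qed

theorem theorem2p18:
  fixes S :: "'a set" and \<sigma> \<alpha> :: "'a \<Rightarrow> 'a" and u v :: "'b::comm_ring_1"
  assumes "hypermap_collection S \<sigma> \<alpha>"
    and "genus S \<sigma> \<alpha> = 0"
  shows "whitney S \<sigma> \<alpha> u v = whitney S (Hilbert_Choice.inv \<alpha> \<circ> \<sigma>) (Hilbert_Choice.inv \<alpha>) v u"
proof -
  have perm: "finite S" "\<sigma> permutes S" "\<alpha> permutes S"
    using assms(1) by (auto simp: hypermap_collection_def)
  note dg = double_genus_eq_0[OF perm assms(2)]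
  show ?thesis
    unfolding whitney_def
  proof (rule sum.reindex_bij_witness[where i = "\<lambda>\<gamma>. \<alpha> \<circ> \<gamma>" and j = "\<lambda>\<beta>. perm_inv \<alpha> \<circ> \<beta>"])
    fix \<beta> assume "\<beta> \<in> {\<beta>. perm_refines S \<beta> \<alpha>}"
    then have \<beta>: "perm_refines S \<beta> \<alpha>" by simp
    show "\<alpha> \<circ> (perm_inv \<alpha> \<circ> \<beta>) = \<beta>"
      using permutes_inv_o(1)[OF perm(3)] by (simp flip: comp_assoc)
    show "perm_inv \<alpha> \<circ> \<beta> \<in> {\<beta>. perm_refines S \<beta> (perm_inv \<alpha>)}"
      using perm_refines_dual[OF perm(1,3) \<beta>] by simp
  next
    fix \<gamma> assume "\<gamma> \<in> {\<beta>. perm_refines S \<beta> (perm_inv \<alpha>)}"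
    \<comment> \<open>Starting from the inverse of \<alpha>, the same duality is left multiplication
      by \<alpha>, so it also provides the inverse map.\<close>
    then show "\<alpha> \<circ> \<gamma> \<in> {\<beta>. perm_refines S \<beta> \<alpha>}"
      using perm_refines_dual[OF perm(1) permutes_inv[OF perm(3)], of \<gamma>]
      by (simp add: permutes_inv_inv[OF perm(3)])
    show "perm_inv \<alpha> \<circ> (\<alpha> \<circ> \<gamma>) = \<gamma>"
      using permutes_inv_o(2)[OF perm(3)] by (simp flip: comp_assoc)
  qed (use perm_refines_dual_exponents[OF perm dg] in \<open>simp add: mult.commute\<close>)
qed

end
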